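(* Let $N\ge1$ and $\alpha\ge0$. Then $\Lambda_\alpha=\Lambda_{\alpha,\mathcal{D}_0}$, and $\|g\|_{\Lambda_\alpha}\sim\|g\|_{\Lambda_{\alpha,\mathcal{D}_0}}$.
   Context: Notation. $[\alpha]$ is the integer part of $\alpha$; $\mathcal{P}_d$ is the collection of polynomials in $\mathbb{R}^N$ of degree less than or equal to $d$; $\chi_Q$ is the characteristic function of $Q$; $|Q|$ is Lebesgue measure. Cubes have sides parallel to the coordinate axes. A function $h$ has vanishing moments up to order $m$ if $\int h(x)\,x^{\beta}\,dx=0$ for all multi-indices $\beta$ with $|\beta|\le m$. The relation $X\sim Y$ means that $c^{-1}X\le Y\le cX$ with a constant $c>0$ depending only on $\alpha$ and $N$, not on $g$. Lipschitz spaces. For $\alpha\ge0$, a cube $Q$ and a locally integrable function $g$, $p_Q(g)$ denotes the unique polynomial in $\mathcal{P}_{[\alpha]}$ such that $[g-p_Q(g)]\chi_Q$ has vanishing moments up to order $[\alpha]$. For a family $\mathcal{J}$ of cubes in $\mathbb{R}^N$ and a locally square-integrable $g$, let $$M^{\sharp,2}_{\alpha,\mathcal{J}}g(x)=\sup_{x\in Q,\,Q\in\mathcal{J}}\frac{1}{|Q|^{\alpha/N}}\left(\frac1{|Q|}\int_Q|g(y)-p_Q(g)(y)|^2\,dy\right)^{1/2}.$$ The space $\Lambda_{\alpha,\mathcal{J}}$ consists of those locally square-integrable $g$ with $M^{\sharp,2}_{\alpha,\mathcal{J}}g\in L^\infty$, and $\|g\|_{\Lambda_{\alpha,\mathcal{J}}}=\|M^{\sharp,2}_{\alpha,\mathcal{J}}g\|_\infty$.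 When $\mathcal{J}$ is the family of all cubes in $\mathbb{R}^N$, one writes $\Lambda_\alpha$ (so $\Lambda_0=\mathrm{BMO}$). Special cubes. $\mathcal{D}_0$ is the collection of all cubes $Q'_{n,k}=I'_{n,k_1}\times\cdots\times I'_{n,k_N}$, where $I'_{n,k}=[(k-1)2^n,(k+1)2^n]$ and $n,k_1,\dots,k_N$ are arbitrary integers. *)

theory Defs
  imports "HOL-Probability.Essential_Supremum"
begin

text \<open>The space is \<open>real ^ 'n\<close>, so \<open>N = CARD('n)\<close>. Multi-indices are functions
  \<open>'n \<Rightarrow> nat\<close>. Functions are real-valued, and elements of the function spaces are
  functions rather than classes modulo equality almost everywhere.\<close>

definition mi_order :: "('n::finite \<Rightarrow> nat) \<Rightarrow> nat" where
  "mi_order \<beta> = (\<Sum>i\<in>UNIV. \<beta> i)"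

definition monomial :: "('n::finite \<Rightarrow> nat) \<Rightarrow> real ^ 'n \<Rightarrow> real" where
  "monomial \<beta> x = (\<Prod>i\<in>UNIV. (x $ i) ^ \<beta> i)"

text \<open>The index set of the sum below is finite, so the sum has its intended meaning.\<close>

lemma finite_mi_order_le: "finite {\<beta> :: 'n::finite \<Rightarrow> nat. mi_order \<beta> \<le> d}"
proof (rule finite_subset)
  show "{\<beta> :: 'n \<Rightarrow> nat. mi_order \<beta> \<le> d} \<subseteq> Pi\<^sub>E UNIV (\<lambda>_. {..d})"
  proof
    fix \<beta> :: "'n \<Rightarrow> nat" assume "\<beta> \<in> {\<beta>. mi_order \<beta> \<le> d}"
    then have "\<beta> i \<le> d" for i
      using member_le_sum[of i UNIV \<beta>] by (auto simp: mi_order_def)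
    then show "\<beta> \<in> Pi\<^sub>E UNIV (\<lambda>_. {..d})" by auto
  qed
  show "finite (Pi\<^sub>E (UNIV :: 'n set) (\<lambda>_. {..d}))"
    by (intro finite_PiE) auto
qed

definition polys :: "nat \<Rightarrow> (real ^ 'n \<Rightarrow> real) set" where
  "polys d = {p. \<exists>c. \<forall>x. p x = (\<Sum>\<beta> | mi_order \<beta> \<le> d. c \<beta> * monomial \<beta> x)}"

text \<open>Integrability is part of the condition, since the Bochner integral of a
  non-integrable function is 0 by convention.\<close>

definition vanishing_moments :: "nat \<Rightarrow> (real ^ 'n \<Rightarrow> real) \<Rightarrow> bool" where
  "vanishing_moments m h \<longleftrightarrow>
     (\<forall>\<beta>. mi_order \<beta> \<le> m \<longrightarrow> has_bochner_integral lebesgue (\<lambda>x. h x * monomial \<beta> x) 0)"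

definition locally_square_integrable :: "(real ^ 'n \<Rightarrow> real) \<Rightarrow> bool" where
  "locally_square_integrable g \<longleftrightarrow>
     g \<in> borel_measurable lebesgue \<and>
     (\<forall>K. compact K \<longrightarrow> set_integrable lebesgue K (\<lambda>x. (g x)\<^sup>2))"

text \<open>The polynomial \<open>p\<^sub>Q(g)\<close>, with \<open>d\<close> in the role of the integer part of \<open>\<alpha>\<close>.\<close>

definition proj_poly :: "nat \<Rightarrow> (real ^ 'n) set \<Rightarrow> (real ^ 'n \<Rightarrow> real) \<Rightarrow> real ^ 'n \<Rightarrow> real" where
  "proj_poly d Q g =
     (THE p. p \<in> polys d \<and> vanishing_moments d (\<lambda>x. (g x - p x) * indicator Q x))"

definition oscillation :: "real \<Rightarrow> (real ^ 'n) set \<Rightarrow> (real ^ 'n \<Rightarrow> real) \<Rightarrow> real" where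
  "oscillation \<alpha> Q g =
     1 / measure lebesgue Q powr (\<alpha> / real CARD('n)) *
     sqrt (1 / measure lebesgue Q *
           (LINT y:Q|lebesgue. \<bar>g y - proj_poly (nat \<lfloor>\<alpha>\<rfloor>) Q g y\<bar>\<^sup>2))"

text \<open>The supremum is taken in the extended nonnegative reals, so it may be infinite, and it
  is 0 at points lying in no member of the family.\<close>

definition sharp_maximal ::
    "real \<Rightarrow> (real ^ 'n) set set \<Rightarrow> (real ^ 'n \<Rightarrow> real) \<Rightarrow> real ^ 'n \<Rightarrow> ennreal" where
  "sharp_maximal \<alpha> J g x = (SUP Q\<in>{Q \<in> J. x \<in> Q}. ennreal (oscillation \<alpha> Q g))"

definition Lip_norm :: "real \<Rightarrow> (real ^ 'n) set set \<Rightarrow> (real ^ 'n \<Rightarrow> real) \<Rightarrow> ennreal" where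
  "Lip_norm \<alpha> J g = esssup lebesgue (sharp_maximal \<alpha> J g)"

definition Lip_space :: "real \<Rightarrow> (real ^ 'n) set set \<Rightarrow> (real ^ 'n \<Rightarrow> real) set" where
  "Lip_space \<alpha> J =
     {g. locally_square_integrable g \<and>
         sharp_maximal \<alpha> J g \<in> borel_measurable lebesgue \<and>
         esssup lebesgue (sharp_maximal \<alpha> J g) < \<infinity>}"

text \<open>Cubes are closed and nondegenerate.\<close>

definition cubes :: "(real ^ 'n) set set" where
  "cubes = {cbox a (\<chi> i. a $ i + l) | a l. 0 < l}"

definition special_cubes :: "(real ^ 'n) set set" where
  "special_cubes =
     {cbox (\<chi> i. (real_of_int (k i) - 1) * 2 powi n) (\<chi> i. (real_of_int (k i) + 1) * 2 powi n)
      | (n :: int) (k :: 'n \<Rightarrow> int). True}"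

end

theory Submission
  imports Defs
begin

text \<open>
  The idea is that the mean oscillation over a cube is controlled by the mean oscillation over any
  larger cube, with a constant that depends only on the ratio of the volumes. The polynomial
  \<open>p\<^sub>Q(g)\<close> is the orthogonal projection of \<open>g\<close> onto the polynomials in \<open>L\<^sup>2(Q)\<close>, hence the best
  polynomial approximation of \<open>g\<close> in that space. If \<open>Q \<subseteq> Q'\<close>, then \<open>p\<^bsub>Q'\<^esub>(g)\<close> competes on \<open>Q\<close>, so
  the squared error \<open>\<integral> \<bar>g - p\<^sub>Q(g)\<bar>\<^sup>2\<close> over \<open>Q\<close> is at most the corresponding error over \<open>Q'\<close>
  (lemma \<open>proj_poly_error_mono\<close>). Taking the normalizations into account,
  the oscillation over \<open>Q\<close> is at most \<open>(\<bar>Q'\<bar> / \<bar>Q\<bar>)\<^bsup>\<alpha>/N + 1/2\<^esup>\<close> times the oscillation over \<open>Q'\<close>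
  (lemma \<open>oscillation_le_oscillation_superset\<close>).

  Every cube lies in a special cube of at most \<open>4\<^sup>N\<close> times its volume: the intervals
  \<open>[(k - 1) 2\<^sup>n, (k + 1) 2\<^sup>n]\<close> of a fixed generation overlap in half their length, so each interval of
  length at most \<open>2\<^sup>n\<close> fits into one of them (lemma \<open>cube_subset_special_cube\<close>). The two maximal
  functions are therefore comparable at every point, and not only their norms.

  What remains is measurability. There are only countably many special cubes, but the supremum over
  all cubes is uncountable. The comparison of nested cubes settles this too: if the
  oscillation over \<open>Q\<close> exceeds \<open>y\<close>, so does the oscillation over a slightly larger concentric cube
  (lemma \<open>cube_enlargement\<close>). Hence the superlevel sets of the full maximal function are open.
\<close>

section \<open>Orthogonal projection in the space of square-integrable functions\<close>

definition square_integrable :: "'a measure \<Rightarrow> ('a \<Rightarrow> real) \<Rightarrow> bool" where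
  "square_integrable M f \<longleftrightarrow> f \<in> borel_measurable M \<and> integrable M (\<lambda>x. (f x)\<^sup>2)"

text \<open>The product is dominated by the sum of the two squares.\<close>

lemma integrable_mult_square_integrable:
  assumes "square_integrable M f" "square_integrable M g"
  shows "integrable M (\<lambda>x. f x * g x)"
proof (rule Bochner_Integration.integrable_bound)
  show "integrable M (\<lambda>x. (f x)\<^sup>2 + (g x)\<^sup>2)"
    using assms by (auto simp: square_integrable_def)
  show "(\<lambda>x. f x * g x) \<in> borel_measurable M"
    using assms by (auto simp: square_integrable_def)
  have "\<bar>u * v\<bar> \<le> u\<^sup>2 + v\<^sup>2" for u v :: real
  proof -
    have "2 * (\<bar>u\<bar> * \<bar>v\<bar>) \<le> u\<^sup>2 + v\<^sup>2"
      using sum_squares_bound[of "\<bar>u\<bar>" "\<bar>v\<bar>"] by (simp add: mult.assoc)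
    moreover have "0 \<le> \<bar>u\<bar> * \<bar>v\<bar>" by simp
    ultimately show ?thesis unfolding abs_mult by linarith
  qed
  then show "AE x in M. norm (f x * g x) \<le> norm ((f x)\<^sup>2 + (g x)\<^sup>2)"
    by (intro AE_I2) simp
qed

lemma square_integrable_cmult:
  "square_integrable M f \<Longrightarrow> square_integrable M (\<lambda>x. c * f x)"
  by (auto simp: square_integrable_def power_mult_distrib)

lemma square_integrable_add:
  assumes "square_integrable M f" "square_integrable M g"
  shows "square_integrable M (\<lambda>x. f x + g x)"
  using assms integrable_mult_square_integrable[OF assms]
  by (auto simp: square_integrable_def power2_sum mult.assoc)

lemma square_integrable_diff:
  assumes "square_integrable M f" "square_integrable M g"
  shows "square_integrable M (\<lambda>x. f x - g x)"
  using square_integrable_add[OF assms(1) square_integrable_cmult[OF assms(2), of "-1"]] by simp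

lemma square_integrable_sum:
  assumes "finite S" "\<And>i. i \<in> S \<Longrightarrow> square_integrable M (\<phi> i)"
  shows "square_integrable M (\<lambda>x. \<Sum>i\<in>S. \<phi> i x)"
  using assms
proof (induction S rule: finite_induct)
  case empty
  then show ?case by (simp add: square_integrable_def)
next
  case (insert k S)
  then have "square_integrable M (\<lambda>x. \<phi> k x + (\<Sum>i\<in>S. \<phi> i x))"
    by (intro square_integrable_add) auto
  with insert show ?case by simp
qed

text \<open>Gram--Schmidt, one function at a time: the new function \<open>\<phi> k\<close> is replaced by its component
  \<open>\<psi>\<close> orthogonal to the old span, and the residual of \<open>g\<close> is corrected by a multiple of \<open>\<psi>\<close>.\<close>

lemma orthogonal_projection_exists:
  assumes "finite S" "\<And>i. i \<in> S \<Longrightarrow> square_integrable M (\<phi> i)" "square_integrable M g"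
  shows "\<exists>c. \<forall>j\<in>S. (\<integral>x. (g x - (\<Sum>i\<in>S. c i * \<phi> i x)) * \<phi> j x \<partial>M) = 0"
  using assms
proof (induction S arbitrary: g rule: finite_induct)
  case empty
  then show ?case by simp
next
  case (insert k S)
  have sq: "square_integrable M (\<phi> i)" if "i \<in> insert k S" for i using insert.prems that by auto
  obtain d where d: "\<And>j. j \<in> S \<Longrightarrow> (\<integral>x. (\<phi> k x - (\<Sum>i\<in>S. d i * \<phi> i x)) * \<phi> j x \<partial>M) = 0"
    using insert.IH[of "\<phi> k"] sq by auto
  obtain c where c: "\<And>j. j \<in> S \<Longrightarrow> (\<integral>x. (g x - (\<Sum>i\<in>S. c i * \<phi> i x)) * \<phi> j x \<partial>M) = 0"
    using insert.IH[of g] sq insert.prems by auto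
  define \<psi> where "\<psi> = (\<lambda>x. \<phi> k x - (\<Sum>i\<in>S. d i * \<phi> i x))"
  define r where "r = (\<lambda>x. g x - (\<Sum>i\<in>S. c i * \<phi> i x))"
  have sq\<psi>: "square_integrable M \<psi>" and sqr: "square_integrable M r"
    unfolding \<psi>_def r_def
    by (intro square_integrable_diff square_integrable_sum square_integrable_cmult sq insert; simp)+
  have orth: "(\<integral>x. \<psi> x * \<phi> j x \<partial>M) = 0" "(\<integral>x. r x * \<phi> j x \<partial>M) = 0" if "j \<in> S" for j
    using c d that by (auto simp: \<psi>_def r_def)
  define t where "t = (\<integral>x. r x * \<psi> x \<partial>M) / (\<integral>x. \<psi> x * \<psi> x \<partial>M)"
  have t: "(\<integral>x. r x * \<psi> x \<partial>M) = t * (\<integral>x. \<psi> x * \<psi> x \<partial>M)"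
  proof (cases "(\<integral>x. \<psi> x * \<psi> x \<partial>M) = 0")
    case True
    \<comment> \<open>Then \<open>\<phi> k\<close> agrees almost everywhere with an element of the old span, and \<open>t = 0\<close> works.\<close>
    then have "AE x in M. \<psi> x * \<psi> x = 0"
      using integrable_mult_square_integrable[OF sq\<psi> sq\<psi>]
      by (subst (asm) integral_nonneg_eq_0_iff_AE) auto
    then have "(\<integral>x. r x * \<psi> x \<partial>M) = 0"
      by (intro integral_eq_zero_AE) auto
    with True show ?thesis by simp
  qed (simp add: t_def)
  define \<rho> where "\<rho> = (\<lambda>x. r x - t * \<psi> x)"
  have sq\<rho>: "square_integrable M \<rho>"
    unfolding \<rho>_def by (intro square_integrable_diff square_integrable_cmult sq\<psi> sqr)
  have orth_S: "(\<integral>x. \<rho> x * \<phi> j x \<partial>M) = 0" if j: "j \<in> S" for j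
  proof -
    have "(\<integral>x. \<rho> x * \<phi> j x \<partial>M) = (\<integral>x. r x * \<phi> j x - t * (\<psi> x * \<phi> j x) \<partial>M)"
      by (simp add: \<rho>_def algebra_simps)
    also have "\<dots> = (\<integral>x. r x * \<phi> j x \<partial>M) - (\<integral>x. t * (\<psi> x * \<phi> j x) \<partial>M)"
      using integrable_mult_square_integrable[OF sqr sq] integrable_mult_square_integrable[OF sq\<psi> sq] j
      by (intro Bochner_Integration.integral_diff) auto
    finally show ?thesis using orth[OF j] by simp
  qed
  have orth_\<psi>: "(\<integral>x. \<rho> x * \<psi> x \<partial>M) = 0"
  proof -
    have "(\<integral>x. \<rho> x * \<psi> x \<partial>M) = (\<integral>x. r x * \<psi> x - t * (\<psi> x * \<psi> x) \<partial>M)"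
      by (simp add: \<rho>_def algebra_simps)
    also have "\<dots> = (\<integral>x. r x * \<psi> x \<partial>M) - (\<integral>x. t * (\<psi> x * \<psi> x) \<partial>M)"
      using integrable_mult_square_integrable[OF sqr sq\<psi>] integrable_mult_square_integrable[OF sq\<psi> sq\<psi>]
      by (intro Bochner_Integration.integral_diff) auto
    finally show ?thesis using t by simp
  qed
  have orth_k: "(\<integral>x. \<rho> x * \<phi> k x \<partial>M) = 0"
  proof -
    have int: "integrable M (\<lambda>x. d i * (\<rho> x * \<phi> i x))" if "i \<in> S" for i
      using integrable_mult_square_integrable[OF sq\<rho> sq] that by auto
    have "(\<integral>x. \<rho> x * \<phi> k x \<partial>M) = (\<integral>x. \<rho> x * \<psi> x + (\<Sum>i\<in>S. d i * (\<rho> x * \<phi> i x)) \<partial>M)"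
      by (simp add: \<psi>_def algebra_simps sum_distrib_left)
    also have "\<dots> = (\<integral>x. \<rho> x * \<psi> x \<partial>M) + (\<integral>x. (\<Sum>i\<in>S. d i * (\<rho> x * \<phi> i x)) \<partial>M)"
      using integrable_mult_square_integrable[OF sq\<rho> sq\<psi>] int
      by (intro Bochner_Integration.integral_add) auto
    also have "(\<integral>x. (\<Sum>i\<in>S. d i * (\<rho> x * \<phi> i x)) \<partial>M) = (\<Sum>i\<in>S. \<integral>x. d i * (\<rho> x * \<phi> i x) \<partial>M)"
      using int by (intro Bochner_Integration.integral_sum) auto
    finally show ?thesis using orth_\<psi> orth_S by simp
  qed
  \<comment> \<open>Substituting \<open>\<psi>\<close> expresses the residual \<open>\<rho>\<close> in terms of the original functions.\<close>
  define c' where "c' = (\<lambda>i. if i = k then t else c i - t * d i)"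
  have "(\<Sum>i\<in>S. c' i * \<phi> i x) = (\<Sum>i\<in>S. c i * \<phi> i x) - t * (\<Sum>i\<in>S. d i * \<phi> i x)" for x
    unfolding sum_distrib_left sum_subtractf[symmetric]
    using \<open>k \<notin> S\<close> by (intro sum.cong) (auto simp: c'_def algebra_simps)
  then have "\<rho> x = g x - (\<Sum>i\<in>insert k S. c' i * \<phi> i x)" for x
    using insert.hyps by (simp add: \<rho>_def r_def \<psi>_def c'_def algebra_simps)
  then show ?case
    using orth_S orth_k by (intro exI[of _ c']) auto
qed

section \<open>Polynomials on a box\<close>

lemma polys_diff:
  assumes "p \<in> polys d" "q \<in> polys d"
  shows "(\<lambda>x. p x - q x) \<in> polys d"
proof -
  obtain a b where "\<And>x. p x = (\<Sum>\<beta> | mi_order \<beta> \<le> d. a \<beta> * monomial \<beta> x)"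
    "\<And>x. q x = (\<Sum>\<beta> | mi_order \<beta> \<le> d. b \<beta> * monomial \<beta> x)"
    using assms by (auto simp: polys_def)
  then show ?thesis
    unfolding polys_def
    by (auto intro!: exI[of _ "\<lambda>\<beta>. a \<beta> - b \<beta>"] simp: sum_subtractf left_diff_distrib)
qed

lemma real_polynomial_function_monomial: "real_polynomial_function (monomial \<beta>)"
proof -
  have "real_polynomial_function (\<lambda>x. x $ i)" for i :: "'n::finite"
    by (rule real_polynomial_function.intros(1)) (rule bounded_linear_vec_nth)
  then show ?thesis
    unfolding monomial_def[abs_def]
    by (intro real_polynomial_function_prod real_polynomial_function_power finite)
qed

lemma real_polynomial_function_polys:
  assumes "p \<in> polys d"
  shows "real_polynomial_function p"
proof -
  obtain c where c: "\<And>x. p x = (\<Sum>\<beta> | mi_order \<beta> \<le> d. c \<beta> * monomial \<beta> x)"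
    using assms unfolding polys_def by blast
  then have "p = (\<lambda>x. \<Sum>\<beta> | mi_order \<beta> \<le> d. c \<beta> * monomial \<beta> x)"
    by (rule ext)
  then show ?thesis
    by (simp only:) (intro real_polynomial_function_sum finite_mi_order_le
        real_polynomial_function.intros(4) real_polynomial_function.intros(2)
        real_polynomial_function_monomial)
qed

text \<open>Restricted to the line through \<open>x\<close> and a point of \<open>U\<close>, the function is a polynomial in one
  variable with infinitely many zeros, so it vanishes on the whole line.\<close>

lemma real_polynomial_function_eq_0_if_open:
  fixes p :: "'a::euclidean_space \<Rightarrow> real"
  assumes p: "real_polynomial_function p" and U: "open U" "U \<noteq> {}" and 0: "\<And>x. x \<in> U \<Longrightarrow> p x = 0"
  shows "p x = 0"
proof -
  obtain u where "u \<in> U" using U by auto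
  define \<gamma> where "\<gamma> = (\<lambda>t::real. u + t *\<^sub>R (x - u))"
  have "polynomial_function \<gamma>"
    unfolding \<gamma>_def
    by (intro polynomial_function_add polynomial_function_const polynomial_function_bounded_linear
        bounded_linear_scaleR_left)
  then have "real_polynomial_function (p \<circ> \<gamma>)"
    using p by (rule real_polynomial_function_compose)
  then obtain a n where an: "p \<circ> \<gamma> = (\<lambda>t. \<Sum>i\<le>n. a i * t ^ i)"
    by (auto simp: real_polynomial_function_iff_sum)
  have "open (\<gamma> -` U)"
    unfolding \<gamma>_def by (intro open_vimage U(1)) (auto intro!: continuous_intros)
  moreover have "0 \<in> \<gamma> -` U"
    using \<open>u \<in> U\<close> by (simp add: \<gamma>_def)
  ultimately have "infinite (\<gamma> -` U)"
    by (metis empty_iff finite_imp_not_open)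
  moreover have "\<gamma> -` U \<subseteq> {t. (\<Sum>i\<le>n. a i * t ^ i) = 0}"
  proof
    fix t assume "t \<in> \<gamma> -` U"
    then show "t \<in> {t. (\<Sum>i\<le>n. a i * t ^ i) = 0}"
      using 0[of "\<gamma> t"] fun_cong[OF an, of t] by simp
  qed
  ultimately have "infinite {t. (\<Sum>i\<le>n. a i * t ^ i) = 0}"
    using finite_subset by blast
  then have "\<forall>i\<le>n. a i = 0"
    using polyfun_finite_roots[of a n] by auto
  then have "(p \<circ> \<gamma>) 1 = 0"
    by (simp add: an)
  then show ?thesis by (simp add: \<gamma>_def)
qed

lemma continuous_imp_square_integrable_compact:
  fixes f :: "'a::euclidean_space \<Rightarrow> real"
  assumes "continuous_on UNIV f" "compact Q"
  shows "square_integrable (lebesgue_on Q) f"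
proof -
  have Q: "Q \<in> sets lebesgue" using assms(2) by (simp add: borel_compact)
  have f: "f \<in> borel_measurable borel" using assms(1) by (rule borel_measurable_continuous_onI)
  have "integrable lborel (\<lambda>x. indicator Q x *\<^sub>R (f x)\<^sup>2)"
    using assms by (intro borel_integrable_compact continuous_intros) (auto intro: continuous_on_subset)
  then have "integrable lebesgue (\<lambda>x. indicator Q x *\<^sub>R (f x)\<^sup>2)"
    by (intro integrable_completion[THEN iffD2]) auto
  then show ?thesis
    using f Q by (auto simp: square_integrable_def integrable_restrict_space
        intro!: measurable_restrict_space1 measurable_completion)
qed

lemma square_integrable_polys:
  assumes "p \<in> polys d" "compact Q"
  shows "square_integrable (lebesgue_on Q) p"
  using assms real_polynomial_function_polys[OF assms(1)]
  by (intro continuous_imp_square_integrable_compact continuous_on_polymonial_function)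
    (auto simp: real_polynomial_function_eq)

lemma square_integrable_monomial:
  assumes "compact Q"
  shows "square_integrable (lebesgue_on Q) (monomial \<beta>)"
  using assms real_polynomial_function_monomial[of \<beta>]
  by (intro continuous_imp_square_integrable_compact continuous_on_polymonial_function)
    (auto simp: real_polynomial_function_eq)

text \<open>Definiteness of the \<open>L\<^sup>2(Q)\<close> norm on polynomials, which makes \<open>p\<^sub>Q(g)\<close> unique. The points of
  the interior where \<open>p\<close> is nonzero form an open null set, which must be empty.\<close>

lemma polys_eq_0_if_integral_square_eq_0:
  fixes p :: "real ^ 'n \<Rightarrow> real"
  assumes p: "p \<in> polys d" and Q: "compact Q" "interior Q \<noteq> {}"
    and 0: "(\<integral>x. (p x)\<^sup>2 \<partial>lebesgue_on Q) = 0"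
  shows "p x = 0"
proof -
  have rp: "real_polynomial_function p" using p by (rule real_polynomial_function_polys)
  then have cont: "continuous_on UNIV p"
    by (intro continuous_on_polymonial_function) (auto simp: real_polynomial_function_eq)
  have Ql: "Q \<in> sets lebesgue" using Q by (simp add: borel_compact)
  have "AE x in lebesgue_on Q. (p x)\<^sup>2 = 0"
    using square_integrable_polys[OF p Q(1)] 0
    by (subst (asm) integral_nonneg_eq_0_iff_AE) (auto simp: square_integrable_def)
  then have AE: "AE x in lebesgue. x \<in> Q \<longrightarrow> p x = 0"
    using Ql by (simp add: AE_restrict_space_iff)
  define V where "V = interior Q \<inter> p -` (- {0})"
  have V: "open V"
    unfolding V_def using cont by (intro open_Int open_interior open_vimage) auto
  have "AE x in lebesgue. x \<notin> V"
    using AE interior_subset by (auto simp: V_def elim!: eventually_mono)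
  then have "V \<in> null_sets lebesgue"
    using V by (subst AE_iff_null_sets) auto
  then have "negligible V"
    by (simp add: negligible_iff_null_sets)
  then have "V = {}"
    using V open_not_negligible by blast
  then have "p x = 0" if "x \<in> interior Q" for x
    using that by (auto simp: V_def)
  then show ?thesis
    by (rule real_polynomial_function_eq_0_if_open[OF rp open_interior Q(2)])
qed

section \<open>The polynomial \<open>p\<^sub>Q(g)\<close> as a best approximation\<close>

lemma square_integrable_if_locally:
  assumes "locally_square_integrable g" "compact Q"
  shows "square_integrable (lebesgue_on Q) g"
proof -
  have Q: "Q \<in> sets lebesgue" using assms(2) by (simp add: borel_compact)
  show ?thesis
    using assms Q
    by (auto simp: square_integrable_def locally_square_integrable_def set_integrable_def
        integrable_restrict_space intro: measurable_restrict_space1)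
qed

text \<open>Monomials are square-integrable on a compact set, so all the moments of \<open>h\<close> exist, and the
  moment condition becomes orthogonality in \<open>L\<^sup>2(Q)\<close>.\<close>

lemma vanishing_moments_iff_orthogonal:
  assumes "square_integrable (lebesgue_on Q) h" "compact Q"
  shows "vanishing_moments d (\<lambda>x. h x * indicator Q x) \<longleftrightarrow>
    (\<forall>\<beta>. mi_order \<beta> \<le> d \<longrightarrow> (\<integral>x. h x * monomial \<beta> x \<partial>lebesgue_on Q) = 0)"
proof -
  have Q: "Q \<in> sets lebesgue" using assms(2) by (simp add: borel_compact)
  have "has_bochner_integral lebesgue (\<lambda>x. h x * indicator Q x * monomial \<beta> x) 0 \<longleftrightarrow>
      has_bochner_integral (lebesgue_on Q) (\<lambda>x. h x * monomial \<beta> x) 0" for \<beta>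
    using Q by (subst has_bochner_integral_restrict_space) (auto simp: mult_ac)
  then show ?thesis
    using integrable_mult_square_integrable[OF assms(1) square_integrable_monomial[OF assms(2)]]
    by (auto simp: vanishing_moments_def has_bochner_integral_iff)
qed

lemma orthogonal_polys:
  assumes h: "square_integrable (lebesgue_on Q) h" "compact Q"
    "vanishing_moments d (\<lambda>x. h x * indicator Q x)" and q: "q \<in> polys d"
  shows "(\<integral>x. h x * q x \<partial>lebesgue_on Q) = 0"
proof -
  obtain c where c: "q = (\<lambda>x. \<Sum>\<beta> | mi_order \<beta> \<le> d. c \<beta> * monomial \<beta> x)"
    using q by (auto simp: polys_def)
  have 0: "(\<integral>x. h x * monomial \<beta> x \<partial>lebesgue_on Q) = 0" if "mi_order \<beta> \<le> d" for \<beta>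
    using h that vanishing_moments_iff_orthogonal by blast
  have "(\<integral>x. h x * q x \<partial>lebesgue_on Q) =
      (\<integral>x. (\<Sum>\<beta> | mi_order \<beta> \<le> d. c \<beta> * (h x * monomial \<beta> x)) \<partial>lebesgue_on Q)"
    by (simp add: c sum_distrib_left mult_ac)
  also have "\<dots> = (\<Sum>\<beta> | mi_order \<beta> \<le> d. \<integral>x. c \<beta> * (h x * monomial \<beta> x) \<partial>lebesgue_on Q)"
    using integrable_mult_square_integrable[OF h(1) square_integrable_monomial[OF h(2)]]
    by (intro Bochner_Integration.integral_sum) auto
  also have "\<dots> = 0" using 0 by simp
  finally show ?thesis .
qed

text \<open>Existence is the orthogonal projection onto the span of the monomials. For uniqueness, the
  difference of two solutions is a polynomial orthogonal to all polynomials of degree at most \<open>d\<close>,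
  itself included, so its \<open>L\<^sup>2(Q)\<close> norm is zero.\<close>

lemma ex1_proj_poly:
  fixes g :: "real ^ 'n \<Rightarrow> real"
  assumes g: "locally_square_integrable g" and Q: "compact Q" "interior Q \<noteq> {}"
  shows "\<exists>!p. p \<in> polys d \<and> vanishing_moments d (\<lambda>x. (g x - p x) * indicator Q x)"
proof (rule ex_ex1I)
  have sqg: "square_integrable (lebesgue_on Q) g"
    using g Q by (intro square_integrable_if_locally)
  obtain c where c: "\<And>j. mi_order j \<le> d \<Longrightarrow>
      (\<integral>x. (g x - (\<Sum>\<beta> | mi_order \<beta> \<le> d. c \<beta> * monomial \<beta> x)) * monomial j x \<partial>lebesgue_on Q) = 0"
    using orthogonal_projection_exists[of "{\<beta>. mi_order \<beta> \<le> d}" "lebesgue_on Q" monomial g]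
      finite_mi_order_le[of d] square_integrable_monomial[OF Q(1)] sqg
    by auto
  define p where "p = (\<lambda>x::real^'n. \<Sum>\<beta> | mi_order \<beta> \<le> d. c \<beta> * monomial \<beta> x)"
  have p: "p \<in> polys d" by (auto simp: p_def polys_def)
  have "square_integrable (lebesgue_on Q) (\<lambda>x. g x - p x)"
    by (intro square_integrable_diff sqg square_integrable_polys[OF p] Q)
  with c p Q show "\<exists>p. p \<in> polys d \<and> vanishing_moments d (\<lambda>x. (g x - p x) * indicator Q x)"
    by (intro exI[of _ p]) (simp add: vanishing_moments_iff_orthogonal p_def)
next
  fix p q :: "real^'n \<Rightarrow> real"
  assume p: "p \<in> polys d \<and> vanishing_moments d (\<lambda>x. (g x - p x) * indicator Q x)"
    and q: "q \<in> polys d \<and> vanishing_moments d (\<lambda>x. (g x - q x) * indicator Q x)"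
  have sqg: "square_integrable (lebesgue_on Q) g"
    using g Q by (intro square_integrable_if_locally)
  define s where "s = (\<lambda>x. p x - q x)"
  have s: "s \<in> polys d" unfolding s_def using p q by (intro polys_diff) auto
  note sq = square_integrable_diff[OF sqg square_integrable_polys[OF conjunct1[OF p] Q(1)]]
    square_integrable_diff[OF sqg square_integrable_polys[OF conjunct1[OF q] Q(1)]]
    square_integrable_polys[OF s Q(1)]
  have "(\<integral>x. (s x)\<^sup>2 \<partial>lebesgue_on Q) =
      (\<integral>x. (g x - q x) * s x - (g x - p x) * s x \<partial>lebesgue_on Q)"
    by (simp add: s_def algebra_simps power2_eq_square)
  also have "\<dots> = (\<integral>x. (g x - q x) * s x \<partial>lebesgue_on Q) - (\<integral>x. (g x - p x) * s x \<partial>lebesgue_on Q)"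
    by (rule Bochner_Integration.integral_diff[OF integrable_mult_square_integrable[OF sq(2,3)]
          integrable_mult_square_integrable[OF sq(1,3)]])
  also have "\<dots> = 0"
    using orthogonal_polys[OF sq(1) Q(1) _ s] orthogonal_polys[OF sq(2) Q(1) _ s] p q by simp
  finally have "s x = 0" for x
    using polys_eq_0_if_integral_square_eq_0[OF s Q] by simp
  then show "p = q" by (auto simp: s_def fun_eq_iff)
qed

lemma
  fixes g :: "real ^ 'n \<Rightarrow> real"
  assumes "locally_square_integrable g" "compact Q" "interior Q \<noteq> {}"
  shows proj_poly_in_polys: "proj_poly d Q g \<in> polys d"
    and vanishing_moments_proj_poly:
      "vanishing_moments d (\<lambda>x. (g x - proj_poly d Q g x) * indicator Q x)"
  using theI'[OF ex1_proj_poly[OF assms]] by (auto simp: proj_poly_def)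

text \<open>Pythagoras: \<open>g - q\<close> splits into \<open>g - p\<^sub>Q(g)\<close> and a polynomial, which are orthogonal.\<close>

lemma proj_poly_best_approximation:
  fixes g :: "real ^ 'n \<Rightarrow> real"
  assumes g: "locally_square_integrable g" and Q: "compact Q" "interior Q \<noteq> {}" and q: "q \<in> polys d"
  shows "(\<integral>x. (g x - proj_poly d Q g x)\<^sup>2 \<partial>lebesgue_on Q) \<le> (\<integral>x. (g x - q x)\<^sup>2 \<partial>lebesgue_on Q)"
proof -
  define p where "p = proj_poly d Q g"
  define s where "s = (\<lambda>x. p x - q x)"
  have p: "p \<in> polys d" unfolding p_def by (intro proj_poly_in_polys g Q)
  have s: "s \<in> polys d" unfolding s_def by (intro polys_diff p q)
  have sq: "square_integrable (lebesgue_on Q) (\<lambda>x. g x - p x)" "square_integrable (lebesgue_on Q) s"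
    using g Q by (intro square_integrable_diff square_integrable_if_locally
        square_integrable_polys[OF p] square_integrable_polys[OF s]; simp)+
  have orth: "(\<integral>x. (g x - p x) * s x \<partial>lebesgue_on Q) = 0"
    using orthogonal_polys[OF sq(1) Q(1) _ s] vanishing_moments_proj_poly[OF g Q, of d]
    by (simp add: p_def)
  have "(\<integral>x. (g x - q x)\<^sup>2 \<partial>lebesgue_on Q) =
      (\<integral>x. (g x - p x)\<^sup>2 + (2 * ((g x - p x) * s x) + (s x)\<^sup>2) \<partial>lebesgue_on Q)"
    by (intro Bochner_Integration.integral_cong) (auto simp: s_def power2_eq_square algebra_simps)
  also have "\<dots> = (\<integral>x. (g x - p x)\<^sup>2 \<partial>lebesgue_on Q) +
      (2 * (\<integral>x. (g x - p x) * s x \<partial>lebesgue_on Q) + (\<integral>x. (s x)\<^sup>2 \<partial>lebesgue_on Q))"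
    using sq integrable_mult_square_integrable[OF sq] by (auto simp: square_integrable_def)
  also have "\<dots> \<ge> (\<integral>x. (g x - p x)\<^sup>2 \<partial>lebesgue_on Q)"
    unfolding orth by simp
  finally show ?thesis by (simp add: p_def)
qed

text \<open>The projection for \<open>Q'\<close> is a competitor on \<open>Q\<close>, and enlarging the domain of integration
  does not decrease the integral of a square.\<close>

lemma proj_poly_error_mono:
  fixes g :: "real ^ 'n \<Rightarrow> real"
  assumes g: "locally_square_integrable g" and Q: "compact Q" "interior Q \<noteq> {}"
    and Q': "compact Q'" "interior Q' \<noteq> {}" and sub: "Q \<subseteq> Q'"
  shows "(\<integral>x. (g x - proj_poly d Q g x)\<^sup>2 \<partial>lebesgue_on Q)
    \<le> (\<integral>x. (g x - proj_poly d Q' g x)\<^sup>2 \<partial>lebesgue_on Q')"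
proof -
  define p where "p = proj_poly d Q' g"
  have p: "p \<in> polys d" unfolding p_def by (intro proj_poly_in_polys g Q')
  have sets: "Q \<in> sets lebesgue" "Q' \<in> sets lebesgue" using Q Q' by (simp_all add: borel_compact)
  have int: "integrable lebesgue (\<lambda>x. indicator K x *\<^sub>R (g x - p x)\<^sup>2)" if K: "compact K" for K
  proof -
    have "square_integrable (lebesgue_on K) (\<lambda>x. g x - p x)"
      using g p K by (intro square_integrable_diff square_integrable_if_locally square_integrable_polys)
    then show ?thesis
      using K by (simp add: square_integrable_def integrable_restrict_space borel_compact)
  qed
  have "(\<integral>x. (g x - proj_poly d Q g x)\<^sup>2 \<partial>lebesgue_on Q) \<le> (\<integral>x. (g x - p x)\<^sup>2 \<partial>lebesgue_on Q)"
    by (intro proj_poly_best_approximation g Q p)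
  also have "\<dots> = (\<integral>x. indicator Q x *\<^sub>R (g x - p x)\<^sup>2 \<partial>lebesgue)"
    using sets by (simp add: integral_restrict_space)
  also have "\<dots> \<le> (\<integral>x. indicator Q' x *\<^sub>R (g x - p x)\<^sup>2 \<partial>lebesgue)"
    using sub by (intro integral_mono int Q Q') (auto simp: indicator_def)
  also have "\<dots> = (\<integral>x. (g x - p x)\<^sup>2 \<partial>lebesgue_on Q')"
    using sets by (simp add: integral_restrict_space)
  finally show ?thesis by (simp add: p_def)
qed

section \<open>Comparison of oscillations over nested cubes\<close>

lemma box_cube_nonempty:
  fixes a :: "real ^ 'n"
  assumes "0 < l"
  shows "box a (\<chi> i. a $ i + l) \<noteq> {}"
proof -
  have "(\<chi> i. a $ i + l / 2) \<in> box a (\<chi> i. a $ i + l)"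
    using assms by (auto simp: mem_box_cart)
  then show ?thesis by auto
qed

lemma content_cube:
  fixes a :: "real ^ 'n"
  assumes "0 < l"
  shows "measure lborel (cbox a (\<chi> i. a $ i + l)) = l ^ CARD('n)"
proof -
  have "cbox a (\<chi> i. a $ i + l) \<noteq> {}"
    using box_cube_nonempty[OF assms, of a] box_subset_cbox by fastforce
  then show ?thesis
    by (simp add: content_cbox_if_cart)
qed

text \<open>Both normalizing powers of \<open>\<bar>Q\<bar>\<close> are collected into one, which reduces the comparison of
  oscillations to a comparison of errors.\<close>

lemma oscillation_eq:
  fixes Q :: "(real ^ 'n) set"
  assumes "measure lebesgue Q > 0" "Q \<in> sets lebesgue"
  shows "oscillation \<alpha> Q g = measure lebesgue Q powr - (\<alpha> / CARD('n) + 1 / 2) *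
    sqrt (\<integral>x. (g x - proj_poly (nat \<lfloor>\<alpha>\<rfloor>) Q g x)\<^sup>2 \<partial>lebesgue_on Q)"
proof -
  have *: "m powr - (a + 1 / 2) = 1 / m powr a * sqrt (1 / m)" if "0 < m" for m a :: real
  proof -
    have "m powr - (a + 1 / 2) = m powr (- a) * m powr (- (1 / 2))"
      unfolding powr_add[symmetric] by simp
    then show ?thesis
      using that by (simp add: powr_minus powr_half_sqrt real_sqrt_divide field_simps)
  qed
  show ?thesis
    unfolding *[OF assms(1)] oscillation_def
    using assms(2) by (simp add: set_lebesgue_integral_def integral_restrict_space real_sqrt_divide)
qed

lemma oscillation_le_oscillation_superset:
  fixes g :: "real ^ 'n \<Rightarrow> real"
  assumes g: "locally_square_integrable g" and "Q \<in> cubes" "Q' \<in> cubes" and sub: "Q \<subseteq> Q'"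
  shows "oscillation \<alpha> Q g \<le>
    (measure lebesgue Q' / measure lebesgue Q) powr (\<alpha> / CARD('n) + 1 / 2) * oscillation \<alpha> Q' g"
proof -
  have *: "compact K" "interior K \<noteq> {}" "K \<in> sets lebesgue" "measure lebesgue K > 0"
    if "K \<in> cubes" for K :: "(real ^ 'n) set"
    using that by (auto simp: cubes_def compact_cbox box_cube_nonempty content_cube)
  note Q = *[OF assms(2)] and Q' = *[OF assms(3)]
  let ?e = "\<alpha> / CARD('n) + 1 / 2"
  let ?m = "measure lebesgue Q" and ?m' = "measure lebesgue Q'"
  have "oscillation \<alpha> Q g \<le> ?m powr - ?e *
      sqrt (\<integral>x. (g x - proj_poly (nat \<lfloor>\<alpha>\<rfloor>) Q' g x)\<^sup>2 \<partial>lebesgue_on Q')"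
    unfolding oscillation_eq[OF Q(4,3)]
    by (intro mult_left_mono real_sqrt_le_mono proj_poly_error_mono g Q Q' sub) auto
  also have "?m powr - ?e = (?m' / ?m) powr ?e * ?m' powr - ?e"
    using Q(4) Q'(4) by (simp add: powr_divide powr_minus field_simps)
  finally show ?thesis
    unfolding oscillation_eq[OF Q'(4,3)] by (simp add: mult.assoc)
qed

lemma oscillation_nonneg: "0 \<le> oscillation \<alpha> Q g"
  by (auto simp: oscillation_def set_lebesgue_integral_def intro!: mult_nonneg_nonneg integral_nonneg)

section \<open>Measurability of the maximal functions\<close>

lemma superlevel_sharp_maximal:
  "{x. y < sharp_maximal \<alpha> J g x} = \<Union>{Q \<in> J. y < ennreal (oscillation \<alpha> Q g)}"
  by (auto simp: sharp_maximal_def less_SUP_iff)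

text \<open>Lower semicontinuity of the maximal function in disguise. Passing to the concentric cube
  with side \<open>l + 2 s\<close> costs a factor \<open>((l + 2 s)\<^sup>N / l\<^sup>N)\<^bsup>\<alpha>/N + 1/2\<^esup>\<close>, which tends to 1 as \<open>s\<close> tends
  to 0, so a strict lower bound survives for small \<open>s\<close>.\<close>

lemma cube_enlargement:
  fixes g :: "real ^ 'n \<Rightarrow> real"
  assumes g: "locally_square_integrable g" and Q: "Q \<in> cubes" and y: "y < ennreal (oscillation \<alpha> Q g)"
  shows "\<exists>Q' \<in> cubes. Q \<subseteq> interior Q' \<and> y < ennreal (oscillation \<alpha> Q' g)"
proof -
  obtain a l where al: "Q = cbox a (\<chi> i. a $ i + l)" "0 < l"
    using Q by (auto simp: cubes_def)
  let ?e = "\<alpha> / CARD('n) + 1 / 2"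
  obtain r where r: "y = ennreal r" "0 \<le> r"
    using y by (cases y) auto
  have rQ: "r < oscillation \<alpha> Q g" using y r by (simp add: ennreal_less_iff)
  define f where "f = (\<lambda>s. ((l + 2 * s) ^ CARD('n) / l ^ CARD('n)) powr ?e * r)"
  have "isCont f 0"
    unfolding f_def using al(2) by (intro continuous_intros) auto
  then have "(f \<longlongrightarrow> r) (at 0)"
    using al(2) by (simp add: isCont_def f_def)
  then have "(f \<longlongrightarrow> r) (at_right 0)"
    by (rule filterlim_mono) (auto simp: at_within_le_at)
  then have "eventually (\<lambda>s. f s < oscillation \<alpha> Q g) (at_right 0)"
    using rQ by (rule order_tendstoD)
  moreover have "eventually (\<lambda>s. 0 < s) (at_right (0::real))"
    by (simp add: eventually_at_right_less)
  ultimately have "eventually (\<lambda>s. f s < oscillation \<alpha> Q g \<and> 0 < s) (at_right 0)"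
    by (rule eventually_conj)
  then obtain s where s: "f s < oscillation \<alpha> Q g" "0 < s"
    using eventually_happens' trivial_limit_at_right_real by blast
  define a' where "a' = (\<chi> i. a $ i - s)"
  define Q' where "Q' = cbox a' (\<chi> i. a' $ i + (l + 2 * s))"
  have Q': "Q' \<in> cubes" using al(2) s(2) by (force simp: cubes_def Q'_def)
  have "Q \<subseteq> interior Q'"
    using al s by (auto simp: Q'_def a'_def interior_cbox mem_box_cart) (smt (verit))+
  moreover have "r < oscillation \<alpha> Q' g"
  proof -
    have m: "measure lebesgue Q = l ^ CARD('n)" "measure lebesgue Q' = (l + 2 * s) ^ CARD('n)"
      using al s content_cube[of l a] content_cube[of "l + 2 * s" a'] by (simp_all add: Q'_def)
    have "f s < ((l + 2 * s) ^ CARD('n) / l ^ CARD('n)) powr ?e * oscillation \<alpha> Q' g"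
      using oscillation_le_oscillation_superset[OF g Q Q', of \<alpha>] \<open>Q \<subseteq> interior Q'\<close> interior_subset s(1) m
      by fastforce
    then show ?thesis
      unfolding f_def by (rule mult_left_less_imp_less) simp
  qed
  ultimately show ?thesis
    using Q' r by (auto intro!: bexI[of _ Q'] simp: ennreal_less_iff)
qed

lemma borel_measurable_sharp_maximal_cubes:
  fixes g :: "real ^ 'n \<Rightarrow> real"
  assumes "locally_square_integrable g"
  shows "sharp_maximal \<alpha> cubes g \<in> borel_measurable lebesgue"
proof (rule borel_measurableI_greater)
  fix y
  have "open {x. y < sharp_maximal \<alpha> cubes g x}"
    unfolding superlevel_sharp_maximal
  proof (subst open_subopen, safe)
    fix x Q assume "x \<in> Q" "Q \<in> cubes" "y < ennreal (oscillation \<alpha> Q g)"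
    then obtain Q' where "Q' \<in> cubes" "Q \<subseteq> interior Q'" "y < ennreal (oscillation \<alpha> Q' g)"
      using cube_enlargement[OF assms] by blast
    then show "\<exists>T. open T \<and> x \<in> T \<and> T \<subseteq> \<Union>{Q \<in> cubes. y < ennreal (oscillation \<alpha> Q g)}"
      using \<open>x \<in> Q\<close> interior_subset by (intro exI[of _ "interior Q'"]) fastforce
  qed
  then show "{x \<in> space lebesgue. y < sharp_maximal \<alpha> cubes g x} \<in> sets lebesgue"
    by simp
qed

lemma borel_measurable_sharp_maximal_countable:
  assumes "countable J" "\<And>Q. Q \<in> J \<Longrightarrow> Q \<in> sets lebesgue"
  shows "sharp_maximal \<alpha> J g \<in> borel_measurable lebesgue"
proof (rule borel_measurableI_greater)
  fix y
  have "\<Union>{Q \<in> J. y < ennreal (oscillation \<alpha> Q g)} \<in> sets lebesgue"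
    using assms by (intro sets.countable_Union) (auto intro: countable_subset[OF _ assms(1)])
  then show "{x \<in> space lebesgue. y < sharp_maximal \<alpha> J g x} \<in> sets lebesgue"
    by (simp add: superlevel_sharp_maximal)
qed

section \<open>Special cubes\<close>

lemma countable_special_cubes: "countable (special_cubes :: (real ^ 'n) set set)"
proof -
  have eq: "special_cubes = range (\<lambda>(n :: int, k :: 'n \<Rightarrow> int).
      cbox (\<chi> i. (real_of_int (k i) - 1) * 2 powi n) (\<chi> i. (real_of_int (k i) + 1) * 2 powi n))"
    unfolding special_cubes_def by fast
  show ?thesis
    unfolding eq by (rule countable_image) (rule countableI_type)
qed

lemma special_cubes_subset_cubes: "special_cubes \<subseteq> cubes"
proof
  fix Q :: "(real ^ 'n) set" assume "Q \<in> special_cubes"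
  then obtain n k where Q: "Q = cbox (\<chi> i. (real_of_int (k i) - 1) * 2 powi n) (\<chi> i. (real_of_int (k i) + 1) * 2 powi n)"
    by (auto simp: special_cubes_def)
  show "Q \<in> cubes"
    unfolding cubes_def Q
    by (intro CollectI exI[of _ "\<chi> i. (real_of_int (k i) - 1) * 2 powi n"] exI[of _ "2 * 2 powi n"])
      (auto simp: algebra_simps)
qed

text \<open>The generation \<open>n\<close> is chosen with \<open>l < 2\<^sup>n \<le> 2 l\<close>, and \<open>k\<^sub>i - 1\<close> is the integer part of
  \<open>a\<^sub>i / 2\<^sup>n\<close>. Then \<open>a\<^sub>i\<close> lies in the left half of the special interval, so that the right half has
  room for length \<open>l\<close>. The special cube has side \<open>2 \<cdot> 2\<^sup>n \<le> 4 l\<close>.\<close>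

lemma cube_subset_special_cube:
  fixes Q :: "(real ^ 'n) set"
  assumes "Q \<in> cubes"
  shows "\<exists>Q' \<in> special_cubes. Q \<subseteq> Q' \<and> measure lebesgue Q' \<le> 4 ^ CARD('n) * measure lebesgue Q"
proof -
  obtain a l where al: "Q = cbox a (\<chi> i. a $ i + l)" "0 < l"
    using assms by (auto simp: cubes_def)
  define n where "n = \<lfloor>log 2 l\<rfloor> + 1"
  define h :: real where "h = 2 powi n"
  have h: "0 < h" "l \<le> h" "h \<le> 2 * l"
  proof -
    have "2 powr real_of_int (n - 1) \<le> l" "l < 2 powr real_of_int (n - 1 + 1)"
      using floor_log_eq_powr_iff[of l 2 "n - 1"] al(2) by (auto simp: n_def)
    moreover have "2 powr real_of_int (n - 1) = h / 2" "2 powr real_of_int (n - 1 + 1) = h"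
      by (simp_all add: h_def powr_diff powr_real_of_int')
    ultimately show "0 < h" "l \<le> h" "h \<le> 2 * l" using al(2) by auto
  qed
  define k where "k = (\<lambda>i. \<lfloor>a $ i / h\<rfloor> + 1)"
  have k: "(real_of_int (k i) - 1) * h \<le> a $ i" "a $ i + l \<le> (real_of_int (k i) + 1) * h" for i
  proof -
    have "real_of_int (k i) - 1 \<le> a $ i / h" "a $ i / h < real_of_int (k i)"
      unfolding k_def by linarith+
    then show "(real_of_int (k i) - 1) * h \<le> a $ i" "a $ i + l \<le> (real_of_int (k i) + 1) * h"
      using h by (auto simp: field_simps)
  qed
  define b where "b = (\<chi> i. (real_of_int (k i) - 1) * h)"
  define Q' where "Q' = cbox b (\<chi> i. (real_of_int (k i) + 1) * h)"
  have eq: "Q' = cbox b (\<chi> i. b $ i + 2 * h)"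
    by (simp add: Q'_def b_def algebra_simps)
  have "Q' \<in> special_cubes"
    by (auto simp: special_cubes_def Q'_def b_def h_def)
  moreover have "Q \<subseteq> Q'"
  proof
    fix x assume "x \<in> Q"
    then have "a $ i \<le> x $ i" "x $ i \<le> a $ i + l" for i
      by (auto simp: al mem_box_cart)
    with k have "(real_of_int (k i) - 1) * h \<le> x $ i" "x $ i \<le> (real_of_int (k i) + 1) * h" for i
      by (meson order_trans)+
    then show "x \<in> Q'"
      by (auto simp: Q'_def b_def mem_box_cart)
  qed
  moreover have "measure lebesgue Q' \<le> 4 ^ CARD('n) * measure lebesgue Q"
  proof -
    have "measure lebesgue Q' = (2 * h) ^ CARD('n)"
      using h by (simp add: eq content_cube)
    also have "\<dots> \<le> (4 * l) ^ CARD('n)"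
      using h by (intro power_mono) auto
    also have "\<dots> = 4 ^ CARD('n) * measure lebesgue Q"
      using al by (simp add: content_cube power_mult_distrib)
    finally show ?thesis .
  qed
  ultimately show ?thesis by blast
qed

lemma sharp_maximal_cubes_le:
  fixes g :: "real ^ 'n \<Rightarrow> real"
  assumes g: "locally_square_integrable g" and "0 \<le> \<alpha>"
  shows "sharp_maximal \<alpha> cubes g x \<le>
    ennreal ((4 ^ CARD('n)) powr (\<alpha> / CARD('n) + 1 / 2)) * sharp_maximal \<alpha> special_cubes g x"
  (is "_ \<le> ennreal ?C * _")
  unfolding sharp_maximal_def[of _ cubes]
proof (rule SUP_least)
  fix Q :: "(real ^ 'n) set" assume "Q \<in> {Q \<in> cubes. x \<in> Q}"
  then have Q: "Q \<in> cubes" "x \<in> Q" by auto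
  obtain Q' where Q': "Q' \<in> special_cubes" "Q \<subseteq> Q'"
    "measure lebesgue Q' \<le> 4 ^ CARD('n) * measure lebesgue Q"
    using cube_subset_special_cube[OF Q(1)] by blast
  have pos: "0 < measure lebesgue Q"
    using Q(1) by (auto simp: cubes_def content_cube)
  have "oscillation \<alpha> Q g \<le>
      (measure lebesgue Q' / measure lebesgue Q) powr (\<alpha> / CARD('n) + 1 / 2) * oscillation \<alpha> Q' g"
    using Q Q' special_cubes_subset_cubes by (intro oscillation_le_oscillation_superset g) auto
  also have "\<dots> \<le> ?C * oscillation \<alpha> Q' g"
    using Q'(3) pos \<open>0 \<le> \<alpha>\<close>
    by (intro mult_right_mono powr_mono2 oscillation_nonneg) (auto simp: field_simps)
  finally have "ennreal (oscillation \<alpha> Q g) \<le> ennreal ?C * ennreal (oscillation \<alpha> Q' g)"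
    by (simp add: ennreal_mult[symmetric] oscillation_nonneg ennreal_leI)
  also have "\<dots> \<le> ennreal ?C * sharp_maximal \<alpha> special_cubes g x"
    unfolding sharp_maximal_def using Q Q' by (intro mult_left_mono SUP_upper) auto
  finally show "ennreal (oscillation \<alpha> Q g) \<le> ennreal ?C * sharp_maximal \<alpha> special_cubes g x" .
qed

theorem proposition2p1:
  fixes \<alpha> :: real
  assumes "0 \<le> \<alpha>"
  shows "(Lip_space \<alpha> cubes :: (real ^ 'n \<Rightarrow> real) set) = Lip_space \<alpha> special_cubes \<and>
    (\<exists>c>0. \<forall>g \<in> (Lip_space \<alpha> cubes :: (real ^ 'n \<Rightarrow> real) set).
       ennreal (inverse c) * Lip_norm \<alpha> cubes g \<le> Lip_norm \<alpha> special_cubes g \<and>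
       Lip_norm \<alpha> special_cubes g \<le> ennreal c * Lip_norm \<alpha> cubes g)"
proof -
  define C :: real where "C = (4 ^ CARD('n)) powr (\<alpha> / CARD('n) + 1 / 2)"
  have C: "1 \<le> C"
    unfolding C_def using assms by (intro ge_one_powr_ge_zero) auto
  have meas: "sharp_maximal \<alpha> cubes g \<in> borel_measurable lebesgue"
    "sharp_maximal \<alpha> special_cubes g \<in> borel_measurable lebesgue"
    if "locally_square_integrable g" for g :: "real ^ 'n \<Rightarrow> real"
  proof -
    have "Q \<in> sets lebesgue" if "Q \<in> special_cubes" for Q :: "(real ^ 'n) set"
      using that by (auto simp: special_cubes_def)
    then show "sharp_maximal \<alpha> special_cubes g \<in> borel_measurable lebesgue"
      by (intro borel_measurable_sharp_maximal_countable countable_special_cubes)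
  qed (rule borel_measurable_sharp_maximal_cubes[OF that])
  have le: "Lip_norm \<alpha> special_cubes g \<le> Lip_norm \<alpha> cubes g"
    if "locally_square_integrable g" for g :: "real ^ 'n \<Rightarrow> real"
    unfolding Lip_norm_def sharp_maximal_def
    using meas(2)[OF that, unfolded sharp_maximal_def] special_cubes_subset_cubes
    by (intro esssup_mono SUP_subset_mono) (auto simp: sharp_maximal_def)
  have ge: "Lip_norm \<alpha> cubes g \<le> ennreal C * Lip_norm \<alpha> special_cubes g"
    if g: "locally_square_integrable g" for g :: "real ^ 'n \<Rightarrow> real"
    unfolding Lip_norm_def
  proof (rule esssup_I[OF meas(1)[OF g]])
    show "AE x in lebesgue. sharp_maximal \<alpha> cubes g x \<le>
        ennreal C * esssup lebesgue (sharp_maximal \<alpha> special_cubes g)"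
      using esssup_AE[of "sharp_maximal \<alpha> special_cubes g" lebesgue]
    proof eventually_elim
      case (elim x)
      then show ?case
        using sharp_maximal_cubes_le[OF g assms, of x] mult_left_mono[OF elim, of "ennreal C"]
        by (auto simp: C_def intro: order_trans)
    qed
  qed
  have "Lip_space \<alpha> cubes = (Lip_space \<alpha> special_cubes :: (real ^ 'n \<Rightarrow> real) set)"
  proof (intro set_eqI iffI)
    fix g :: "real ^ 'n \<Rightarrow> real"
    assume "g \<in> Lip_space \<alpha> cubes"
    then show "g \<in> Lip_space \<alpha> special_cubes"
      using le[of g] meas[of g] by (auto simp: Lip_space_def Lip_norm_def intro: le_less_trans)
  next
    fix g :: "real ^ 'n \<Rightarrow> real"
    assume g: "g \<in> Lip_space \<alpha> special_cubes"
    then have "ennreal C * Lip_norm \<alpha> special_cubes g < \<infinity>"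
      by (auto simp: Lip_space_def Lip_norm_def ennreal_mult_less_top)
    with g show "g \<in> Lip_space \<alpha> cubes"
      using ge[of g] meas[of g] by (auto simp: Lip_space_def Lip_norm_def intro: le_less_trans)
  qed
  moreover have "ennreal (inverse C) * Lip_norm \<alpha> cubes g \<le> Lip_norm \<alpha> special_cubes g \<and>
       Lip_norm \<alpha> special_cubes g \<le> ennreal C * Lip_norm \<alpha> cubes g"
    if "g \<in> Lip_space \<alpha> cubes" for g :: "real ^ 'n \<Rightarrow> real"
  proof
    have g: "locally_square_integrable g" using that by (simp add: Lip_space_def)
    have "ennreal (inverse C) * Lip_norm \<alpha> cubes g \<le>
        ennreal (inverse C) * (ennreal C * Lip_norm \<alpha> special_cubes g)"
      by (intro mult_left_mono ge g) simp
    also have "\<dots> = Lip_norm \<alpha> special_cubes g"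
      using C by (simp add: mult.assoc[symmetric] ennreal_mult[symmetric])
    finally show "ennreal (inverse C) * Lip_norm \<alpha> cubes g \<le> Lip_norm \<alpha> special_cubes g" .
    have "Lip_norm \<alpha> special_cubes g \<le> 1 * Lip_norm \<alpha> cubes g"
      using le[OF g] by simp
    also have "\<dots> \<le> ennreal C * Lip_norm \<alpha> cubes g"
      using C by (intro mult_right_mono) auto
    finally show "Lip_norm \<alpha> special_cubes g \<le> ennreal C * Lip_norm \<alpha> cubes g" .
  qed
  ultimately show ?thesis
    using C by (intro conjI exI[of _ C]) auto
qed

end
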